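(* Let $n\in\mathbb{N}$, let $f\colon\mathbb{R}^n\to\mathbb{R}^n$ satisfy $f(0_n)=0_n$, let $\mathcal{X}\subseteq\mathbb{R}^n$ satisfy $0_n\in\mathrm{int}(\mathcal{X})$, and assume $0_n\in\mathrm{int}(\mathcal{D}_0^{\mathcal{X}})$. Let $\mathcal{V}\subseteq\mathcal{X}$ be a safe region of attraction within $\mathcal{X}$. Define the sequence of sets $\{\mathcal{V}_k\}_{k\in\mathbb{Z}_+}$ by $\mathcal{V}_0=\mathcal{V}$ and $\mathcal{V}_{k+1}=f^{-1}(\mathcal{V}_k)\cap\mathcal{X}$ for $k\in\mathbb{Z}_+$. Then $\mathcal{V}_k$ is a safe region of attraction within $\mathcal{X}$ for all $k\in\mathbb{Z}_+$, $\mathcal{V}_k\subseteq\mathcal{V}_{k+1}$ for all $k\in\mathbb{Z}_+$, and $\bigcup_{k\in\mathbb{Z}_+}\mathcal{V}_k=\mathcal{D}_0^{\mathcal{X}}$.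
   Context: $\mathbb{Z}_+$ denotes the non-negative integers, $0_n$ the zero vector of $\mathbb{R}^n$, $\mathrm{int}$ the topological interior in $\mathbb{R}^n$, and $f^{-1}(Q)=\{x\in\mathbb{R}^n \mid f(x)\in Q\}$ the preimage ($f$ need not be invertible or continuous). Consider the discrete-time system $x_{k+1}=f(x_k)$, $k\in\mathbb{Z}_+$. The trajectory starting from $x\in\mathbb{R}^n$ is $\varphi_x\colon\mathbb{Z}_+\to\mathbb{R}^n$, $\varphi_x(0)=x$, $\varphi_x(k+1)=f(\varphi_x(k))=f^{k+1}(x)$. The safe domain of attraction within $\mathcal{X}$ is $$\mathcal{D}_0^{\mathcal{X}}=\{x\in\mathbb{R}^n \mid \varphi_x(k)\in\mathcal{X}\ \forall k\in\mathbb{Z}_+,\ \lim_{k\to\infty}\varphi_x(k)=0_n\}.$$ A subset $\mathcal{S}\subseteq\mathbb{R}^n$ is called a safe region of attraction within $\mathcal{X}$ iff $\mathcal{S}\subseteq\mathcal{D}_0^{\mathcal{X}}$, $0_n\in\mathrm{int}(\mathcal{S})$, and $f(\mathcal{S})\subseteq\mathcal{S}$. *)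

theory Defs
  imports "HOL-Analysis.Analysis"
begin

primrec trajectory :: "(real ^ 'n \<Rightarrow> real ^ 'n) \<Rightarrow> real ^ 'n \<Rightarrow> nat \<Rightarrow> real ^ 'n" where
  "trajectory f x 0 = x"
| "trajectory f x (Suc k) = f (trajectory f x k)"

definition safe_doa :: "(real ^ 'n \<Rightarrow> real ^ 'n) \<Rightarrow> (real ^ 'n) set \<Rightarrow> (real ^ 'n) set" where
  "safe_doa f X = {x. (\<forall>k. trajectory f x k \<in> X) \<and> trajectory f x \<longlonglongrightarrow> 0}"

definition safe_roa ::
    "(real ^ 'n \<Rightarrow> real ^ 'n) \<Rightarrow> (real ^ 'n) set \<Rightarrow> (real ^ 'n) set \<Rightarrow> bool" where
  "safe_roa f X S \<longleftrightarrow> S \<subseteq> safe_doa f X \<and> 0 \<in> interior S \<and> f ` S \<subseteq> S"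

primrec preimage_seq ::
    "(real ^ 'n \<Rightarrow> real ^ 'n) \<Rightarrow> (real ^ 'n) set \<Rightarrow> (real ^ 'n) set \<Rightarrow> nat \<Rightarrow> (real ^ 'n) set" where
  "preimage_seq f X V 0 = V"
| "preimage_seq f X V (Suc k) = f -` preimage_seq f X V k \<inter> X"

end

theory Submission
  imports Defs
begin

text \<open>
  Membership in the safe domain of attraction is unaffected by one step of the dynamics: a point
  lies in it iff the point is in \<open>X\<close> and its image lies in it, because the limit of a trajectory
  does not see the first term (\<open>safe_doa_iff_step\<close>). Hence pulling a safe region of attraction
  back along \<open>f\<close> and cutting with \<open>X\<close> stays inside the domain. Forward invariance of the region
  says exactly that the pull-back contains it, which yields both the monotonicity of the sequence
  and that \<open>0\<close> remains an interior point (\<open>safe_roa_preimage\<close>).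
  The union exhausts the domain since every trajectory that tends to \<open>0\<close> enters the neighbourhood
  \<open>V\<close> of \<open>0\<close> after finitely many, say \<open>k\<close>, steps; if it stays in \<open>X\<close> meanwhile, its starting point
  lies in the \<open>k\<close>-th set (\<open>mem_preimage_seq_if_trajectory\<close>).
\<close>

lemma trajectory_step: "trajectory f (f x) k = trajectory f x (Suc k)"
  by (induction k) auto

lemma safe_doa_iff_step: "x \<in> safe_doa f X \<longleftrightarrow> x \<in> X \<and> f x \<in> safe_doa f X"
proof -
  have "(\<forall>k. trajectory f x k \<in> X) \<longleftrightarrow> x \<in> X \<and> (\<forall>k. trajectory f (f x) k \<in> X)"
    unfolding trajectory_step by (metis not0_implies_Suc trajectory.simps(1))
  moreover have "trajectory f x \<longlonglongrightarrow> 0 \<longleftrightarrow> trajectory f (f x) \<longlonglongrightarrow> 0"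
    unfolding trajectory_step[abs_def] by (rule filterlim_sequentially_Suc[symmetric])
  ultimately show ?thesis
    by (auto simp: safe_doa_def)
qed

lemma safe_roa_subset_preimage:
  assumes "safe_roa f X S"
  shows "S \<subseteq> f -` S \<inter> X"
  using assms safe_doa_iff_step[of _ f X] unfolding safe_roa_def by blast

text \<open>The interior condition is inherited from \<open>S\<close>, which forward invariance places inside the
  pull-back.\<close>

lemma safe_roa_preimage:
  assumes "safe_roa f X S"
  shows "safe_roa f X (f -` S \<inter> X)"
  unfolding safe_roa_def
proof (intro conjI)
  note sub = safe_roa_subset_preimage[OF assms]
  show "f -` S \<inter> X \<subseteq> safe_doa f X"
    using assms safe_doa_iff_step[of _ f X] unfolding safe_roa_def by blast
  show "0 \<in> interior (f -` S \<inter> X)"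
    using assms interior_mono[OF sub] unfolding safe_roa_def by blast
  show "f ` (f -` S \<inter> X) \<subseteq> f -` S \<inter> X"
    using sub by blast
qed

lemma safe_roa_preimage_seq:
  assumes "safe_roa f X V"
  shows "safe_roa f X (preimage_seq f X V k)"
  by (induction k) (simp_all add: assms safe_roa_preimage)

lemma mem_preimage_seq_if_trajectory:
  assumes "\<And>j. j < k \<Longrightarrow> trajectory f x j \<in> X" and "trajectory f x k \<in> V"
  shows "x \<in> preimage_seq f X V k"
  using assms
proof (induction k arbitrary: x)
  case 0
  then show ?case by simp
next
  case (Suc k)
  have "f x \<in> preimage_seq f X V k"
    by (rule Suc.IH) (simp_all only: trajectory_step Suc.prems Suc_less_eq)
  moreover have "x \<in> X"
    using Suc.prems(1)[of 0] by simp
  ultimately show ?case by simp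
qed

lemma safe_doa_subset_Union_preimage_seq:
  assumes "0 \<in> interior V"
  shows "safe_doa f X \<subseteq> (\<Union>k. preimage_seq f X V k)"
proof
  fix x assume "x \<in> safe_doa f X"
  then have in_X: "\<And>j. trajectory f x j \<in> X" and lim: "trajectory f x \<longlonglongrightarrow> 0"
    by (auto simp: safe_doa_def)
  obtain k where "trajectory f x k \<in> interior V"
    using topological_tendstoD[OF lim open_interior assms]
    by (auto simp: eventually_sequentially)
  then have "x \<in> preimage_seq f X V k"
    using in_X interior_subset by (intro mem_preimage_seq_if_trajectory) auto
  then show "x \<in> (\<Union>k. preimage_seq f X V k)" by blast
qed

theorem theorem5:
  fixes f :: "real ^ 'n \<Rightarrow> real ^ 'n" and X V :: "(real ^ 'n) set"
  assumes "f 0 = 0"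
    and "0 \<in> interior X"
    and "0 \<in> interior (safe_doa f X)"
    and "V \<subseteq> X"
    and "safe_roa f X V"
  shows "(\<forall>k. safe_roa f X (preimage_seq f X V k))
    \<and> (\<forall>k. preimage_seq f X V k \<subseteq> preimage_seq f X V (Suc k))
    \<and> (\<Union>k. preimage_seq f X V k) = safe_doa f X"
proof (intro conjI allI equalityI)
  note roa = safe_roa_preimage_seq[OF assms(5)]
  show "safe_roa f X (preimage_seq f X V k)" for k
    by (rule roa)
  show "preimage_seq f X V k \<subseteq> preimage_seq f X V (Suc k)" for k
    using safe_roa_subset_preimage[OF roa] by simp
  show "(\<Union>k. preimage_seq f X V k) \<subseteq> safe_doa f X"
    using roa unfolding safe_roa_def by blast
  show "safe_doa f X \<subseteq> (\<Union>k. preimage_seq f X V k)"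
    using assms(5) unfolding safe_roa_def by (intro safe_doa_subset_Union_preimage_seq) blast
qed

end
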